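(* Let $v,k,\lambda,n$ be integers with $n\ge 2$. If a $(v,k,\lambda)$ projection $n$-cube with $k\ge 2$ exists, then $$n\le \frac{vk-1}{k-1}.$$
   Context: A symmetric $(v,k,\lambda)$ design is identified with its incidence matrix: it is a $v\times v$ matrix $A$ with entries in $\{0,1\}$ satisfying $A A^t=(k-\lambda)I+\lambda J$, where $I$ is the identity matrix and $J$ the all-ones matrix; as in the usual definition of symmetric block designs, every column of $A$ also contains exactly $k$ ones (this is automatic when $\lambda<k$). Let $\mathbb{F}$ be a field of characteristic $0$. An $n$-dimensional matrix of order $v$ over $\mathbb{F}$ ($n\ge 2$) is a function $C:\{1,\ldots,v\}^n\to\mathbb{F}$. For $1\le x<y\le n$, the projection $\Pi_{xy}(C)$ is the $v\times v$ matrix whose $(i_x,i_y)$-entry is the sum (in $\mathbb{F}$) of $C(i_1,\ldots,i_n)$ over all $n$-tuples $(i_1,\ldots,i_n)\in\{1,\ldots,v\}^n$ with the coordinates $i_x$ and $i_y$ fixed. A $(v,k,\lambda)$ projection $n$-cube is an $n$-dimensional matrix $C:\{1,\ldots,v\}^n\to\mathbb{F}$ with entries in $\{0,1\}$ such that all projections $\Pi_{xy}(C)$, $1\le x<y\le n$, are symmetric $(v,k,\lambda)$ designs. *)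

theory Defs
  imports Complex_Main "HOL-Library.FuncSet" "Jordan_Normal_Form.Matrix"
begin

definition all_ones_mat :: "nat \<Rightarrow> 'a::one mat" where
  "all_ones_mat v = mat v v (\<lambda>_. 1)"

(* A design is identified with its incidence matrix, whose order is positive.  That every row
   contains exactly k ones is the diagonal part of the matrix equation. *)
definition symmetric_design :: "nat \<Rightarrow> int \<Rightarrow> int \<Rightarrow> 'a::field_char_0 mat \<Rightarrow> bool" where
  "symmetric_design v k l A \<longleftrightarrow>
     0 < v \<and>
     A \<in> carrier_mat v v \<and>
     elements_mat A \<subseteq> {0, 1} \<and>
     A * transpose_mat A = (of_int k - of_int l) \<cdot>\<^sub>m 1\<^sub>m v + of_int l \<cdot>\<^sub>m all_ones_mat v \<and>
     (\<forall>j<v. int (card {i. i < v \<and> A $$ (i, j) = 1}) = k)"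

definition cube_index :: "nat \<Rightarrow> nat \<Rightarrow> (nat \<Rightarrow> nat) set" where
  "cube_index n v = {1..n} \<rightarrow>\<^sub>E {1..v}"

(* An n-dimensional matrix of order v is a function on n-tuples, of which only the values on
   cube_index n v are relevant.  Matrix indices start at 0 while the coordinates of a tuple
   start at 1, hence Suc. *)
definition projection :: "nat \<Rightarrow> nat \<Rightarrow> nat \<Rightarrow> nat \<Rightarrow> ((nat \<Rightarrow> nat) \<Rightarrow> 'a::field_char_0) \<Rightarrow> 'a mat" where
  "projection n v x y C =
     mat v v (\<lambda>(a, b). \<Sum>i\<in>{i \<in> cube_index n v. i x = Suc a \<and> i y = Suc b}. C i)"

definition projection_cube ::
  "nat \<Rightarrow> nat \<Rightarrow> int \<Rightarrow> int \<Rightarrow> ((nat \<Rightarrow> nat) \<Rightarrow> 'a::field_char_0) \<Rightarrow> bool" where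
  "projection_cube n v k l C \<longleftrightarrow>
     (\<forall>i\<in>cube_index n v. C i \<in> {0, 1}) \<and>
     (\<forall>x y. 1 \<le> x \<and> x < y \<and> y \<le> n \<longrightarrow> symmetric_design v k l (projection n v x y C))"

end

theory Submission
  imports Defs
begin

text \<open>Regard the positions of the ones of a projection cube as a code \<open>S\<close>: a set of words of
  length \<open>n\<close> over an alphabet of \<open>v\<close> letters. The entry of a projection at \<open>(a, b)\<close> is the number of
  codewords with letters \<open>a\<close> and \<open>b\<close> at the two chosen places. Since the characteristic is zero, an
  entry in \<open>{0, 1}\<close> means that two distinct codewords agree in at most one place
  (\<open>codewords_agree_at_most_once\<close>). Row and column sums of a projection count the codewords with a
  prescribed letter at one place, so each letter occurs exactly \<open>k\<close> times at each place
  (\<open>card_codewords_with_letter\<close>), and \<open>S\<close> has \<open>vk\<close> words.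

  Now fix a codeword \<open>w\<close>. At each of the \<open>n\<close> places, \<open>k - 1\<close> other codewords agree with \<open>w\<close>, and
  these \<open>n\<close> groups are pairwise disjoint. Hence \<open>n (k - 1) \<le> vk - 1\<close>
  (\<open>card_places_times_agreeing_le\<close>).\<close>

definition support :: "nat \<Rightarrow> nat \<Rightarrow> ((nat \<Rightarrow> nat) \<Rightarrow> 'a::field_char_0) \<Rightarrow> (nat \<Rightarrow> nat) set" where
  "support n v C = {i \<in> cube_index n v. C i = 1}"

lemma finite_cube_index: "finite (cube_index n v)"
  by (simp add: cube_index_def finite_PiE)

lemma finite_support: "finite (support n v C)"
  by (simp add: support_def finite_cube_index)

lemma support_letter:
  assumes "i \<in> support n v C" "x \<in> {1..n}"
  shows "i x \<in> {1..v}"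
  using assms by (auto simp: support_def cube_index_def dest: PiE_mem)

lemma projection_entry:
  assumes "\<forall>i\<in>cube_index n v. C i \<in> {0, 1}" "a < v" "b < v"
  shows "projection n v x y C $$ (a, b) =
    of_nat (card {i \<in> support n v C. i x = Suc a \<and> i y = Suc b})"
proof -
  let ?P = "{i \<in> cube_index n v. i x = Suc a \<and> i y = Suc b}"
  have "projection n v x y C $$ (a, b) = (\<Sum>i\<in>?P. C i)"
    using assms(2,3) by (simp add: projection_def)
  also have "\<dots> = (\<Sum>i\<in>?P. if C i = 1 then 1 else 0)"
    using assms(1) by (intro sum.cong) auto
  also have "\<dots> = of_nat (card {i \<in> ?P. C i = 1})"
    by (subst sum.inter_filter[symmetric]) (simp_all add: finite_cube_index)
  also have "{i \<in> ?P. C i = 1} = {i \<in> support n v C. i x = Suc a \<and> i y = Suc b}"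
    by (auto simp: support_def)
  finally show ?thesis .
qed

lemma card_eq_sum_over_letters:
  assumes "finite T" "\<And>i. i \<in> T \<Longrightarrow> i y \<in> {1..v::nat}"
  shows "card T = (\<Sum>b<v. card {i \<in> T. i y = Suc b})"
proof -
  have "T = (\<Union>b<v. {i \<in> T. i y = Suc b})"
  proof (intro equalityI subsetI)
    fix i assume "i \<in> T"
    with assms(2) have "i y - 1 < v" "i y = Suc (i y - 1)" by force+
    with \<open>i \<in> T\<close> show "i \<in> (\<Union>b<v. {i \<in> T. i y = Suc b})" by blast
  qed auto
  then have "card T = card (\<Union>b<v. {i \<in> T. i y = Suc b})" by simp
  also have "\<dots> = (\<Sum>b<v. card {i \<in> T. i y = Suc b})"
    using assms(1) by (intro card_UN_disjoint) auto
  finally show ?thesis .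
qed

lemma design_entry:
  assumes "symmetric_design v k l A" "a < v" "b < v"
  shows "A $$ (a, b) \<in> {0, 1}"
  using assms unfolding symmetric_design_def elements_mat_def by fastforce

text \<open>The diagonal of \<open>A A\<^sup>t\<close> holds the sums of squares of the rows, and the entries are
  idempotent.\<close>

lemma design_row_sum:
  assumes "symmetric_design v k l A" "a < v"
  shows "(\<Sum>b<v. A $$ (a, b)) = of_int k"
proof -
  have A: "A \<in> carrier_mat v v"
    and eq: "A * transpose_mat A = (of_int k - of_int l) \<cdot>\<^sub>m 1\<^sub>m v + of_int l \<cdot>\<^sub>m all_ones_mat v"
    using assms(1) by (auto simp: symmetric_design_def)
  have "(\<Sum>b<v. A $$ (a, b)) = (\<Sum>b<v. A $$ (a, b) * A $$ (a, b))"
  proof (intro sum.cong refl)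
    fix b assume "b \<in> {..<v}"
    then show "A $$ (a, b) = A $$ (a, b) * A $$ (a, b)"
      using design_entry[OF assms, of b] by auto
  qed
  also have "\<dots> = (A * transpose_mat A) $$ (a, a)"
    using A assms(2) by (simp add: scalar_prod_def atLeast0LessThan)
  also have "\<dots> = of_int k"
    using assms(2) by (simp add: eq all_ones_mat_def)
  finally show ?thesis .
qed

lemma design_column_sum:
  assumes "symmetric_design v k l A" "b < v"
  shows "(\<Sum>a<v. A $$ (a, b)) = of_int k"
proof -
  have "(\<Sum>a<v. A $$ (a, b)) = (\<Sum>a<v. if A $$ (a, b) = 1 then 1 else 0)"
  proof (intro sum.cong refl)
    fix a assume "a \<in> {..<v}"
    then show "A $$ (a, b) = (if A $$ (a, b) = 1 then 1 else 0)"
      using design_entry[OF assms(1) _ assms(2), of a] by auto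
  qed
  also have "\<dots> = of_nat (card {a \<in> {..<v}. A $$ (a, b) = 1})"
    by (subst sum.inter_filter[symmetric]) simp_all
  also have "\<dots> = of_int (int (card {a. a < v \<and> A $$ (a, b) = 1}))"
    by simp
  also have "\<dots> = of_int k"
    using assms by (simp add: symmetric_design_def)
  finally show ?thesis .
qed

lemma codewords_agree_at_most_once:
  assumes C: "projection_cube n v k l C"
    and xy: "x \<in> {1..n}" "y \<in> {1..n}" "x \<noteq> y"
    and i: "i \<in> support n v C" "j \<in> support n v C" "i x = j x" "i y = j y"
  shows "i = j"
  using xy i(3,4)
  \<comment> \<open>Only the projections with \<open>x < y\<close> are known to be designs.\<close>
proof (induction x y rule: linorder_wlog)
  case (le x y)
  obtain a b where ab: "j x = Suc a" "j y = Suc b" "a < v" "b < v"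
    using support_letter[OF i(2) le(2)] support_letter[OF i(2) le(3)]
    by (cases "j x"; cases "j y") auto
  let ?T = "{i \<in> support n v C. i x = Suc a \<and> i y = Suc b}"
  have "of_nat (card ?T) \<in> {0, 1::'a}"
    using C ab le design_entry[of v k l "projection n v x y C" a b]
    by (simp add: projection_cube_def projection_entry)
  then have "card ?T \<le> 1"
    by auto
  moreover have "i \<in> ?T" "j \<in> ?T" "finite ?T"
    using i ab le by (auto simp: finite_support)
  ultimately show ?case
    using card_le_Suc0_iff_eq[of ?T] by auto
next
  case (sym x y)
  show ?case
    by (rule sym.IH[OF sym.prems(2,1) sym.prems(3)[symmetric] sym.prems(5,4)])
qed

text \<open>Every place \<open>x\<close> is either a row place of some projection or, if it is the last one, a column
  place; the former uses the design equation and the latter the column condition.\<close>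

lemma card_codewords_with_letter:
  assumes C: "projection_cube n v k l C" and n: "n \<ge> 2" and x: "x \<in> {1..n}"
    and a: "a \<in> {1..v}"
  shows "int (card {i \<in> support n v C. i x = a}) = k"
proof -
  obtain a' where a': "a = Suc a'" "a' < v"
    using a by (cases a) auto
  have entries: "\<forall>i\<in>cube_index n v. C i \<in> {0, 1}"
    using C by (simp add: projection_cube_def)
  let ?T = "{i \<in> support n v C. i x = a}"
  have split: "card ?T = (\<Sum>b<v. card {i \<in> ?T. i y = Suc b})" if "y \<in> {1..n}" for y
    using that by (intro card_eq_sum_over_letters) (simp add: finite_support, use support_letter in blast)
  have "of_nat (card ?T) = (of_int k :: 'a)"
  proof (cases "x < n")
    case True
    have "of_nat (card ?T) = (\<Sum>b<v. projection n v x n C $$ (a', b))"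
      using split[of n] n a' by (simp add: projection_entry[OF entries] conj_assoc)
    also have "\<dots> = of_int k"
      using C True x a' by (intro design_row_sum[where l = l]) (auto simp: projection_cube_def)
    finally show ?thesis .
  next
    case False
    then have "x = n" using x by simp
    have "of_nat (card ?T) = (\<Sum>b<v. projection n v 1 x C $$ (b, a'))"
      using split[of 1] n a' by (simp add: projection_entry[OF entries] conj_ac)
    also have "\<dots> = of_int k"
      using C n a' \<open>x = n\<close> by (intro design_column_sum[where l = l]) (auto simp: projection_cube_def)
    finally show ?thesis .
  qed
  then have "of_int (int (card ?T)) = (of_int k :: 'a)" by simp
  then show ?thesis by (simp only: of_int_eq_iff)
qed

text \<open>The sets of words other than \<open>w\<close> that agree with \<open>w\<close> at \<open>x\<close> are disjoint for different \<open>x\<close>,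
  and all of them miss \<open>w\<close> itself.\<close>

lemma card_places_times_agreeing_le:
  assumes fin: "finite S" "finite X" and w: "w \<in> S"
    and agree: "\<And>x. x \<in> X \<Longrightarrow> card {i \<in> S. i x = w x} = m"
    and once: "\<And>x y i. x \<in> X \<Longrightarrow> y \<in> X \<Longrightarrow> x \<noteq> y \<Longrightarrow> i \<in> S \<Longrightarrow> i x = w x \<Longrightarrow> i y = w y \<Longrightarrow> i = w"
  shows "card X * (m - 1) \<le> card S - 1"
proof -
  let ?D = "\<lambda>x. {i \<in> S. i x = w x} - {w}"
  have "card X * (m - 1) = (\<Sum>x\<in>X. card (?D x))"
    using w agree by simp
  also have "\<dots> = card (\<Union>x\<in>X. ?D x)"
    using fin once by (intro card_UN_disjoint[symmetric]) auto
  also have "\<dots> \<le> card (S - {w})"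
    using fin by (intro card_mono) auto
  finally show ?thesis
    using w by simp
qed

theorem theorem2p9:
  fixes v n :: nat and k l :: int
  assumes "n \<ge> 2" and "k \<ge> 2"
    and "\<exists>C :: (nat \<Rightarrow> nat) \<Rightarrow> 'a::field_char_0. projection_cube n v k l C"
  shows "real n \<le> (real v * real_of_int k - 1) / (real_of_int k - 1)"
proof -
  obtain C :: "(nat \<Rightarrow> nat) \<Rightarrow> 'a" where C: "projection_cube n v k l C"
    using assms(3) by blast
  define m where "m = nat k"
  have k: "k = int m" and m: "m \<ge> 2"
    using assms(2) by (auto simp: m_def)
  let ?S = "support n v C"
  have letter: "card {i \<in> ?S. i x = a} = m" if "x \<in> {1..n}" "a \<in> {1..v}" for x a
    using card_codewords_with_letter[OF C assms(1) that] k by simp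
  have "symmetric_design v k l (projection n v 1 2 C)"
    using C assms(1) by (simp add: projection_cube_def)
  then have v: "v > 0"
    by (simp add: symmetric_design_def)
  have "card ?S = (\<Sum>a<v. card {i \<in> ?S. i 1 = Suc a})"
  proof (rule card_eq_sum_over_letters[OF finite_support])
    show "i 1 \<in> {1..v}" if "i \<in> ?S" for i
      using support_letter[OF that, of 1] assms(1) by simp
  qed
  also have "\<dots> = v * m"
    using letter[of 1] assms(1) by simp
  finally have card_S: "card ?S = v * m" .
  then have "?S \<noteq> {}"
    using v m by auto
  then obtain w where w: "w \<in> ?S" by blast
  have "card {1..n} * (m - 1) \<le> card ?S - 1"
  proof (rule card_places_times_agreeing_le[OF finite_support _ w])
    show "card {i \<in> ?S. i x = w x} = m" if "x \<in> {1..n}" for x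
      using letter[OF that support_letter[OF w that]] .
    show "i = w" if "x \<in> {1..n}" "y \<in> {1..n}" "x \<noteq> y" "i \<in> ?S" "i x = w x" "i y = w y" for x y i
      using codewords_agree_at_most_once[OF C that(1-4) w that(5,6)] .
  qed simp
  then have "real (n * (m - 1)) \<le> real (v * m - 1)"
    by (simp only: card_S card_atLeastAtMost of_nat_le_iff) simp
  moreover have "v * m \<ge> 1"
    using v m by simp
  ultimately have "real n * (real m - 1) \<le> real v * real m - 1"
    using m by simp
  then show ?thesis
    using m by (simp add: k le_divide_eq)
qed

end
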